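(* Let $r\ge2$ be a fixed integer and let $p=p(m)\in[0,1]$ satisfy $p=\omega\left(m^{-1/\binom{r}{2}}\right)$. Then $$\chi_1(K(m,r,p))=r=\chi(K(m,r,p))$$ with probability tending to one as $m$ tends to infinity.
   Context: $K(m,r,p)$ denotes the probability space of all labeled $r$-partite graphs with each partite set having size $m$, where any two vertices in different parts are joined with probability $p$ independently of all other pairs. $\chi$ is the ordinary chromatic number. For a graph $F$, a 1-selection of $F$ is a mapping $f$ assigning to each (non-isolated) vertex $v$ of $F$ an edge $f(v)\in E(F)$ with $v\in f(v)$ (nothing is assigned to isolated vertices). The 1-removed graph $F_f$ has vertex set $V(F)$ and edge set $E(F)$ minus the image of $f$. The 1-robust chromatic number is $\chi_1(F)=\min_f\chi(F_f)$, the minimum taken over all 1-selections $f$ of $F$. *)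

theory Defs
  imports "HOL-Probability.Probability" "HOL-Library.Landau_Symbols"
begin

text \<open>A graph is a pair of a vertex set and a set of edges, an edge being the two-element set of
  its endpoints.\<close>

type_synonym 'a graph = "'a set \<times> 'a set set"

abbreviation verts :: "'a graph \<Rightarrow> 'a set" where "verts \<equiv> fst"
abbreviation edges :: "'a graph \<Rightarrow> 'a set set" where "edges \<equiv> snd"

definition proper_colouring :: "'a graph \<Rightarrow> nat \<Rightarrow> ('a \<Rightarrow> nat) \<Rightarrow> bool" where
  "proper_colouring F k c \<longleftrightarrow>
     c ` verts F \<subseteq> {..<k} \<and> (\<forall>u v. {u, v} \<in> edges F \<longrightarrow> c u \<noteq> c v)"

text \<open>The least number is attained for every finite loopless graph.\<close>

definition chromatic_number :: "'a graph \<Rightarrow> nat" where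
  "chromatic_number F = (LEAST k. \<exists>c. proper_colouring F k c)"

definition non_isolated :: "'a graph \<Rightarrow> 'a set" where
  "non_isolated F = {v \<in> verts F. \<exists>e \<in> edges F. v \<in> e}"

text \<open>Selections are total functions in HOL; their values off the non-isolated vertices are
  arbitrary and are never used.\<close>

definition one_selection :: "'a graph \<Rightarrow> ('a \<Rightarrow> 'a set) \<Rightarrow> bool" where
  "one_selection F f \<longleftrightarrow> (\<forall>v \<in> non_isolated F. f v \<in> edges F \<and> v \<in> f v)"

definition one_removed :: "'a graph \<Rightarrow> ('a \<Rightarrow> 'a set) \<Rightarrow> 'a graph" where
  "one_removed F f = (verts F, edges F - f ` non_isolated F)"

text \<open>Every graph has a 1-selection, so this infimum over a nonempty set of naturals is a
  minimum.\<close>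

definition one_robust_chromatic_number :: "'a graph \<Rightarrow> nat" where
  "one_robust_chromatic_number F = (INF f \<in> {f. one_selection F f}. chromatic_number (one_removed F f))"

text \<open>The vertex \<open>(i, a)\<close> is the \<open>a\<close>-th vertex of the \<open>i\<close>-th part.\<close>

definition partite_verts :: "nat \<Rightarrow> nat \<Rightarrow> (nat \<times> nat) set" where
  "partite_verts m r = {..<r} \<times> {..<m}"

definition cross_pairs :: "nat \<Rightarrow> nat \<Rightarrow> (nat \<times> nat) set set" where
  "cross_pairs m r =
     {{u, v} | u v. u \<in> partite_verts m r \<and> v \<in> partite_verts m r \<and> fst u \<noteq> fst v}"

text \<open>One independent Bernoulli trial of parameter \<open>p\<close> for each pair of vertices in different
  parts; the pairs whose trial succeeds are the edges.\<close>

definition random_partite_graph :: "nat \<Rightarrow> nat \<Rightarrow> real \<Rightarrow> (nat \<times> nat) graph pmf" where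
  "random_partite_graph m r p =
     map_pmf (\<lambda>b. (partite_verts m r, {e \<in> cross_pairs m r. b e}))
       (Pi_pmf (cross_pairs m r) False (\<lambda>_. bernoulli_pmf p))"

end

theory Submission imports Defs begin

text \<open>
  Colouring by parts uses \<open>r\<close> colours, so both numbers are at most \<open>r\<close>. Since removing edges does
  not increase the chromatic number, everything reduces to showing that, with high probability,
  no 1-removed graph has a proper colouring with fewer than \<open>r\<close> colours.

  In such a colouring every part has a majority colour, used on at least \<open>m / (r - 1)\<close> of its
  vertices, and two of the \<open>r\<close> parts must share it. This gives two sets \<open>A\<close> and \<open>B\<close> of at
  least \<open>m / (r - 1)\<close> vertices in different parts such that all edges between them were removed.
  A removed edge between \<open>A\<close> and \<open>B\<close> is selected by one of its own ends, that is by a vertex of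
  \<open>A \<union> B\<close>, so there are at most \<open>card A + card B \<le> 2 * m\<close> of them
  (\<open>dense_between_large_sets_not_colourable\<close>).

  In the random graph, however, the expected number of edges between \<open>A\<close> and \<open>B\<close> is at least
  \<open>p * m\<^sup>2 / (r - 1)\<^sup>2\<close>. As soon as \<open>p * m\<close> is a large constant, a Chernoff bound
  (\<open>prob_few_successes_le\<close>) makes the probability of at most \<open>2 * m\<close> edges so small that it
  survives a union bound over the at most \<open>r\<^sup>2 * 4 ^ m\<close> choices of the two parts and of \<open>A\<close> and \<open>B\<close>
  (\<open>prob_not_dense_le\<close>). The growth condition on \<open>p\<close> makes \<open>p * m\<close> tend to
  infinity, because \<open>r choose 2\<close> is at least 1.
\<close>

section \<open>Chromatic numbers\<close>

lemma chromatic_number_eqI: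
  assumes "proper_colouring F k c" and "\<And>l d. l < k \<Longrightarrow> \<not> proper_colouring F l d"
  shows "chromatic_number F = k"
  unfolding chromatic_number_def
  using assms by (intro Least_equality) (blast, meson not_le)

lemma proper_colouring_mono:
  assumes "proper_colouring F k c" "verts G = verts F" "edges G \<subseteq> edges F"
  shows "proper_colouring G k c"
  using assms unfolding proper_colouring_def by auto

lemma one_selection_exists: "\<exists>f. one_selection F f"
  unfolding one_selection_def non_isolated_def
  by (intro exI[of _ "\<lambda>v. SOME e. e \<in> edges F \<and> v \<in> e"]) (auto intro: someI2)

lemma one_robust_chromatic_number_eqI:
  assumes "\<And>f. one_selection F f \<Longrightarrow> chromatic_number (one_removed F f) = k"
  shows "one_robust_chromatic_number F = k"
proof -
  have "(\<lambda>f. chromatic_number (one_removed F f)) ` {f. one_selection F f} = {k}"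
    using assms one_selection_exists[of F] by auto
  then show ?thesis unfolding one_robust_chromatic_number_def by simp
qed

section \<open>Partite graphs with many edges between large sets\<close>

definition pairs_between :: "nat \<Rightarrow> nat set \<Rightarrow> nat \<Rightarrow> nat set \<Rightarrow> (nat \<times> nat) set set" where
  "pairs_between i A j B = (\<lambda>(a, b). {(i, a), (j, b)}) ` (A \<times> B)"

lemma card_pairs_between:
  assumes "i \<noteq> j"
  shows "card (pairs_between i A j B) = card A * card B"
proof -
  have "inj_on (\<lambda>(a, b). {(i, a), (j, b)}) (A \<times> B)"
    using assms by (auto simp: inj_on_def doubleton_eq_iff)
  then show ?thesis
    unfolding pairs_between_def by (simp add: card_image card_cartesian_product)
qed

lemma pairs_between_subset_cross_pairs:
  assumes "i < r" "j < r" "i \<noteq> j" "A \<subseteq> {..<m}" "B \<subseteq> {..<m}"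
  shows "pairs_between i A j B \<subseteq> cross_pairs m r"
proof
  fix e assume "e \<in> pairs_between i A j B"
  then obtain a b where e: "e = {(i, a), (j, b)}" and ab: "a \<in> A" "b \<in> B"
    unfolding pairs_between_def by auto
  show "e \<in> cross_pairs m r"
    unfolding cross_pairs_def partite_verts_def mem_Collect_eq e
    using ab assms by (intro exI[of _ "(i, a)"] exI[of _ "(j, b)"]) auto
qed

lemma finite_cross_pairs: "finite (cross_pairs m r)"
proof (rule finite_subset)
  show "cross_pairs m r \<subseteq> Pow (partite_verts m r)"
    unfolding cross_pairs_def by auto
qed (simp add: partite_verts_def)

text \<open>The conditions on the cardinalities state that \<open>A\<close> and \<open>B\<close> have at least \<open>m / (r - 1)\<close>
  elements, the size that averaging over \<open>r - 1\<close> colours guarantees for a majority colour class.\<close>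

definition large_set_pairs :: "nat \<Rightarrow> nat \<Rightarrow> (nat \<times> nat \<times> nat set \<times> nat set) set" where
  "large_set_pairs m r = {(i, j, A, B). i < r \<and> j < r \<and> i \<noteq> j \<and> A \<subseteq> {..<m} \<and> B \<subseteq> {..<m} \<and>
     m \<le> (r - 1) * card A \<and> m \<le> (r - 1) * card B}"

text \<open>The threshold \<open>2 * m\<close> is the number of vertices in two parts, hence an upper bound for the
  number of edges that a 1-selection can remove between them.\<close>

definition dense_between_large_sets :: "nat \<Rightarrow> nat \<Rightarrow> (nat \<times> nat) set set \<Rightarrow> bool" where
  "dense_between_large_sets m r E \<longleftrightarrow>
     (\<forall>(i, j, A, B) \<in> large_set_pairs m r. 2 * m < card (E \<inter> pairs_between i A j B))"

lemma large_colour_class: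
  fixes h :: "'a \<Rightarrow> nat"
  assumes "finite S" "S \<noteq> {}" "h ` S \<subseteq> {..<k}"
  shows "\<exists>t<k. card S \<le> k * card {a \<in> S. h a = t}"
proof (rule ccontr)
  assume "\<not> ?thesis"
  then have small: "k * card {a \<in> S. h a = t} < card S" if "t < k" for t
    using that by (auto simp: not_le)
  have k: "k > 0" using assms by auto
  have "S = (\<Union>t<k. {a \<in> S. h a = t})" using assms(3) by auto
  then have "card S \<le> (\<Sum>t<k. card {a \<in> S. h a = t})"
    by (metis card_UN_le finite_lessThan)
  then have "k * card S \<le> (\<Sum>t<k. k * card {a \<in> S. h a = t})"
    by (simp add: sum_distrib_left[symmetric])
  also have "\<dots> < (\<Sum>t<k. card S)"
    using k small by (intro sum_strict_mono) auto
  finally show False by simp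
qed

text \<open>Two parts with the same majority colour would have all edges between their majority classes
  removed; each such edge is selected by a vertex of these classes, which allows at most \<open>2 * m\<close>
  removals, fewer than the number of edges there.\<close>

lemma dense_between_large_sets_not_colourable:
  assumes E: "E \<subseteq> cross_pairs m r" and dense: "dense_between_large_sets m r E"
    and m: "m > 0" and f: "one_selection (partite_verts m r, E) f" and k: "k < r"
  shows "\<not> proper_colouring (one_removed (partite_verts m r, E) f) k c"
proof
  assume "proper_colouring (one_removed (partite_verts m r, E) f) k c"
  then have col: "c ` partite_verts m r \<subseteq> {..<k}"
    and proper: "\<And>u v. {u, v} \<in> E - f ` non_isolated (partite_verts m r, E) \<Longrightarrow> c u \<noteq> c v"
    unfolding proper_colouring_def one_removed_def by auto
  have "\<exists>t<k. m \<le> k * card {a \<in> {..<m}. c (i, a) = t}" if "i < r" for i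
    using large_colour_class[of "{..<m}" "\<lambda>a. c (i, a)" k] col m that
    by (force simp: partite_verts_def)
  then obtain t where t: "\<And>i. i < r \<Longrightarrow> t i < k"
    and large: "\<And>i. i < r \<Longrightarrow> m \<le> k * card {a \<in> {..<m}. c (i, a) = t i}"
    by metis
  have "card (t ` {..<r}) \<le> card {..<k}"
    using t by (intro card_mono) auto
  then have "\<not> inj_on t {..<r}"
    using k by (auto dest: card_image)
  then obtain i j where ij: "i < r" "j < r" "i \<noteq> j" "t i = t j"
    unfolding inj_on_def by auto
  define A where "A = {a \<in> {..<m}. c (i, a) = t i}"
  define B where "B = {a \<in> {..<m}. c (j, a) = t j}"
  have "k * card A \<le> (r - 1) * card A" "k * card B \<le> (r - 1) * card B"
    using k by (intro mult_right_mono; simp)+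
  moreover have "m \<le> k * card A" "m \<le> k * card B"
    using large ij unfolding A_def B_def by blast+
  ultimately have "m \<le> (r - 1) * card A" "m \<le> (r - 1) * card B"
    by linarith+
  moreover have AB: "A \<subseteq> {..<m}" "B \<subseteq> {..<m}"
    unfolding A_def B_def by auto
  ultimately have "(i, j, A, B) \<in> large_set_pairs m r"
    using ij unfolding large_set_pairs_def by blast
  then have many: "2 * m < card (E \<inter> pairs_between i A j B)"
    using dense unfolding dense_between_large_sets_def by auto
  have "E \<inter> pairs_between i A j B \<subseteq> f ` ({i} \<times> A \<union> {j} \<times> B)"
  proof
    fix e assume e: "e \<in> E \<inter> pairs_between i A j B"
    then obtain a b where ab: "e = {(i, a), (j, b)}" "a \<in> A" "b \<in> B"
      unfolding pairs_between_def by auto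
    have "c (i, a) = c (j, b)" using ab ij unfolding A_def B_def by auto
    then obtain v where v: "v \<in> non_isolated (partite_verts m r, E)" "e = f v"
      using proper[of "(i, a)" "(j, b)"] e unfolding ab(1) by blast
    then have "v \<in> e" using f unfolding one_selection_def by auto
    then have "v \<in> {i} \<times> A \<union> {j} \<times> B" using ab by auto
    then show "e \<in> f ` ({i} \<times> A \<union> {j} \<times> B)" using v(2) by (rule rev_image_eqI)
  qed
  then have "card (E \<inter> pairs_between i A j B) \<le> card (f ` ({i} \<times> A \<union> {j} \<times> B))"
    by (intro card_mono) (auto simp: A_def B_def)
  also have "\<dots> \<le> card ({i} \<times> A \<union> {j} \<times> B)"
    by (intro card_image_le) (auto simp: A_def B_def)
  also have "\<dots> \<le> card A + card B"
    using card_Un_le[of "{i} \<times> A" "{j} \<times> B"] by (simp add: card_cartesian_product)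
  also have "\<dots> \<le> 2 * m"
    using AB[THEN card_mono[OF finite_lessThan]] by simp
  finally show False using many by simp
qed

lemma partite_colouring:
  assumes "E \<subseteq> cross_pairs m r"
  shows "proper_colouring (partite_verts m r, E) r fst"
  using assms unfolding proper_colouring_def partite_verts_def cross_pairs_def
  by (fastforce simp: doubleton_eq_iff)

lemma chromatic_numbers_of_dense_partite_graph:
  assumes E: "E \<subseteq> cross_pairs m r" and "dense_between_large_sets m r E" and "m > 0"
  shows "one_robust_chromatic_number (partite_verts m r, E) = r"
    and "chromatic_number (partite_verts m r, E) = r"
proof -
  let ?F = "(partite_verts m r, E)"
  note not_col = dense_between_large_sets_not_colourable[OF assms]
  note mono = proper_colouring_mono[where F = ?F and G = "one_removed ?F f" for f]
  show "one_robust_chromatic_number ?F = r"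
    using not_col partite_colouring[OF E]
    by (intro one_robust_chromatic_number_eqI chromatic_number_eqI mono)
      (auto simp: one_removed_def)
  obtain f where "one_selection ?F f" using one_selection_exists by blast
  then have "\<not> proper_colouring ?F k c" if "k < r" for k c
    using not_col mono that unfolding one_removed_def fst_conv snd_conv by blast
  then show "chromatic_number ?F = r"
    using partite_colouring[OF E] by (intro chromatic_number_eqI)
qed

section \<open>The random graph\<close>

text \<open>The Chernoff method for the number \<open>X\<close> of successes in \<open>S\<close>: Markov's inequality is applied to
  \<open>(1/2) ^ X\<close>, whose expectation factors by independence into \<open>(1 - p / 2) ^ card S\<close>. The base
  \<open>1/2\<close> is not optimal, but it keeps all constants rational.\<close>

lemma prob_few_successes_le:
  fixes p :: real
  assumes p: "p \<in> {0..1}" and I: "finite I" and S: "S \<subseteq> I"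
  shows "measure_pmf.prob (Pi_pmf I False (\<lambda>_. bernoulli_pmf p)) {b. card {e \<in> S. b e} \<le> k}
           \<le> 2 ^ k * exp (- (p * real (card S) / 2))"
proof -
  let ?M = "Pi_pmf I False (\<lambda>_. bernoulli_pmf p)"
  \<comment> \<open>The product of these factors is \<open>1/2\<close> to the power of the number of successes in \<open>S\<close>.\<close>
  define g :: "'a \<Rightarrow> bool \<Rightarrow> real" where "g = (\<lambda>e x. if e \<in> S \<and> x then 1/2 else 1)"
  have fS: "finite S" using I S by (rule finite_subset[rotated])
  have pow: "(\<Prod>e\<in>I. g e (b e)) = (1/2) ^ card {e \<in> S. b e}" for b
  proof -
    have "(\<Prod>e\<in>I. g e (b e)) = (\<Prod>e\<in>{e \<in> S. b e}. 1/2)"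
      using I S by (intro prod.mono_neutral_cong_right) (auto simp: g_def)
    then show ?thesis by simp
  qed
  have "measure_pmf.prob ?M {b. card {e \<in> S. b e} \<le> k}
      = measure_pmf.prob ?M {b. (1/2) ^ k \<le> (\<Prod>e\<in>I. g e (b e))}"
    unfolding pow by (simp add: power_decreasing_iff)
  also have "\<dots> \<le> measure_pmf.expectation ?M (\<lambda>b. \<Prod>e\<in>I. g e (b e)) / (1/2) ^ k"
  proof -
    have "integrable (measure_pmf ?M) (\<lambda>b. \<Prod>e\<in>I. g e (b e))"
      by (rule measure_pmf.integrable_const_bound[of _ 1])
        (auto simp: pow abs_mult power_le_one)
    then show ?thesis
      using integral_Markov_inequality_measure[of "measure_pmf ?M" "\<lambda>b. \<Prod>e\<in>I. g e (b e)" UNIV "(1/2)^k"]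
      by (auto simp: pow)
  qed
  also have "measure_pmf.expectation ?M (\<lambda>b. \<Prod>e\<in>I. g e (b e))
      = (\<Prod>e\<in>I. measure_pmf.expectation (bernoulli_pmf p) (g e))"
    using I by (rule expectation_prod_Pi_pmf) (auto intro!: integrable_measure_pmf_finite simp: g_def)
  also have "\<dots> = (\<Prod>e\<in>S. 1 - p / 2)"
    using I S p by (intro prod.mono_neutral_cong_right) (auto simp: g_def field_simps)
  also have "\<dots> = (1 - p / 2) ^ card S" by simp
  also have "\<dots> \<le> exp (- (p / 2)) ^ card S"
    using p exp_ge_add_one_self[of "- (p / 2)"] by (intro power_mono) auto
  also have "\<dots> = exp (- (p * real (card S) / 2))"
    by (simp add: exp_of_nat_mult[symmetric] mult_ac)
  finally show ?thesis
    by (simp add: divide_right_mono power_divide mult.commute)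
qed

lemma finite_large_set_pairs: "finite (large_set_pairs m r)"
  and card_large_set_pairs_le: "card (large_set_pairs m r) \<le> r\<^sup>2 * 4 ^ m"
proof -
  let ?X = "{..<r} \<times> {..<r} \<times> Pow {..<m} \<times> Pow {..<m}"
  have sub: "large_set_pairs m r \<subseteq> ?X" unfolding large_set_pairs_def by auto
  show "finite (large_set_pairs m r)" by (rule finite_subset[OF sub]) auto
  have "card ?X = r\<^sup>2 * 4 ^ m"
    by (simp add: card_cartesian_product card_Pow power2_eq_square power_mult_distrib[symmetric])
  then show "card (large_set_pairs m r) \<le> r\<^sup>2 * 4 ^ m"
    using card_mono[OF _ sub] by simp
qed

text \<open>A union bound. There are at most \<open>r\<^sup>2 * 4 ^ m\<close> pairs of large sets, and for each of them the
  Chernoff bound is \<open>4 ^ m * exp (- (p * N / 2))\<close> with \<open>N\<close> the number of vertex pairs. The constant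
  10 makes the exponential at most \<open>exp (- 5) ^ m \<le> (1/32) ^ m\<close>, which beats the two factors
  \<open>4 ^ m\<close>.\<close>

lemma prob_not_dense_le:
  fixes p :: real
  assumes p: "p \<in> {0..1}" and r: "r \<ge> 2" and pm: "10 * (real r - 1)\<^sup>2 \<le> p * real m"
  shows "measure_pmf.prob (Pi_pmf (cross_pairs m r) False (\<lambda>_. bernoulli_pmf p))
           {b. \<not> dense_between_large_sets m r {e \<in> cross_pairs m r. b e}}
           \<le> real (r\<^sup>2) * (1/2) ^ m"
proof -
  let ?M = "Pi_pmf (cross_pairs m r) False (\<lambda>_. bernoulli_pmf p)"
  define bad where "bad = (\<lambda>(i, j, A, B). {b. card {e \<in> pairs_between i A j B. b e} \<le> 2 * m})"
  have each: "measure_pmf.prob ?M (bad x) \<le> (1/8) ^ m" if x: "x \<in> large_set_pairs m r" for x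
  proof -
    obtain i j A B where x_eq: "x = (i, j, A, B)" by (metis surj_pair)
    have ij: "i < r" "j < r" "i \<noteq> j" and AB: "A \<subseteq> {..<m}" "B \<subseteq> {..<m}"
      and large: "m \<le> (r - 1) * card A" "m \<le> (r - 1) * card B"
      using x unfolding x_eq large_set_pairs_def by auto
    have "real (r - 1) = real r - 1" using r by (simp add: of_nat_diff)
    then have "real m \<le> (real r - 1) * card A" "real m \<le> (real r - 1) * card B"
      using large[THEN of_nat_mono, where ?'a = real] by simp_all
    then have "real m * real m \<le> ((real r - 1) * card A) * ((real r - 1) * card B)"
      using r by (intro mult_mono) auto
    then have "(real r - 1)\<^sup>2 * (10 * real m) \<le> (real r - 1)\<^sup>2 * (p * (card A * card B))"
      using mult_right_mono[OF pm, of "real m"] p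
        mult_left_mono[of "real m * real m" "((real r - 1) * card A) * ((real r - 1) * card B)" p]
      by (simp add: power2_eq_square mult_ac)
    then have N: "10 * real m \<le> p * real (card (pairs_between i A j B))"
      using r ij by (simp add: card_pairs_between)
    have "measure_pmf.prob ?M (bad x)
        \<le> 2 ^ (2 * m) * exp (- (p * real (card (pairs_between i A j B)) / 2))"
      unfolding bad_def x_eq prod.case
      using p finite_cross_pairs pairs_between_subset_cross_pairs[OF ij AB]
      by (rule prob_few_successes_le)
    also have "\<dots> \<le> 2 ^ (2 * m) * exp (real m * (- 5))"
      using N by simp
    also have "\<dots> = (4 * exp (- 5)) ^ m"
      by (simp only: exp_of_nat_mult power_mult power_mult_distrib) simp
    also have "\<dots> \<le> (1/8) ^ m"
    proof (rule power_mono)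
      have "(2::real) ^ 5 \<le> exp 1 ^ 5"
        using exp_ge_add_one_self[of 1] by (intro power_mono) auto
      then have "(32::real) \<le> exp 5" by (simp add: exp_of_nat_mult[symmetric])
      then show "4 * exp (- 5) \<le> (1/8 :: real)" by (simp add: exp_minus field_simps)
    qed simp
    finally show ?thesis .
  qed
  have "{e \<in> cross_pairs m r. b e} \<inter> pairs_between i A j B = {e \<in> pairs_between i A j B. b e}"
    if "(i, j, A, B) \<in> large_set_pairs m r" for i j A B b
    using that pairs_between_subset_cross_pairs[of i r j A m B]
    unfolding large_set_pairs_def by auto
  then have "{b. \<not> dense_between_large_sets m r {e \<in> cross_pairs m r. b e}}
      = (\<Union>x \<in> large_set_pairs m r. bad x)"
    unfolding dense_between_large_sets_def bad_def by (fastforce simp: not_less)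
  then have "measure_pmf.prob ?M {b. \<not> dense_between_large_sets m r {e \<in> cross_pairs m r. b e}}
      \<le> (\<Sum>x \<in> large_set_pairs m r. measure_pmf.prob ?M (bad x))"
    using finite_large_set_pairs
    by (auto intro!: measure_pmf.finite_measure_subadditive_finite)
  also have "\<dots> \<le> real (card (large_set_pairs m r)) * (1/8) ^ m"
    using each by (rule sum_bounded_above)
  also have "\<dots> \<le> real (r\<^sup>2 * 4 ^ m) * (1/8) ^ m"
    using card_large_set_pairs_le by (intro mult_right_mono of_nat_mono) auto
  also have "\<dots> = real (r\<^sup>2) * (1/2) ^ m"
    by (simp add: power_mult_distrib[symmetric] mult.assoc)
  finally show ?thesis .
qed

theorem theorem1p10:
  fixes r :: nat and p :: "nat \<Rightarrow> real"
  assumes "r \<ge> 2"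
    and "\<And>m. p m \<in> {0..1}"
    and "p \<in> \<omega>(\<lambda>m. real m powr (- 1 / real (r choose 2)))"
  shows "(\<lambda>m. measure_pmf.prob (random_partite_graph m r (p m))
            {G. one_robust_chromatic_number G = r \<and> chromatic_number G = r}) \<longlonglongrightarrow> 1"
proof -
  let ?P = "\<lambda>m. measure_pmf.prob (random_partite_graph m r (p m))
            {G. one_robust_chromatic_number G = r \<and> chromatic_number G = r}"
  have "1 \<le> r choose 2"
    using assms(1) by (simp add: Suc_le_eq zero_less_binomial_iff)
  then have exponent: "- 1 \<le> - 1 / real (r choose 2)"
    by (auto simp: divide_le_eq)
  \<comment> \<open>The lower bound on \<open>p m * m\<close> that the union bound requires.\<close>
  define C where "C = 10 * (real r - 1)\<^sup>2"
  have C: "C > 0" using assms(1) unfolding C_def by simp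
  have "\<forall>\<^sub>F m in sequentially. norm (p m) \<ge> C * norm (real m powr (- 1 / real (r choose 2)))"
    using smallomegaD[OF assms(3)] .
  then have lower: "\<forall>\<^sub>F m in sequentially. 1 - real (r\<^sup>2) * (1/2) ^ m \<le> ?P m"
    using eventually_gt_at_top[of 0]
  proof eventually_elim
    case (elim m)
    let ?M = "Pi_pmf (cross_pairs m r) False (\<lambda>_. bernoulli_pmf (p m))"
    have "C * (1 / real m) \<le> C * real m powr (- 1 / real (r choose 2))"
      using powr_mono[OF exponent, of "real m"] elim(2) C
      by (intro mult_left_mono) (auto simp: powr_minus_divide)
    also have "\<dots> \<le> p m" using elim(1) assms(2)[of m] by simp
    finally have "C \<le> p m * real m" using elim(2) by (simp add: field_simps)
    then have "measure_pmf.prob ?M {b. \<not> dense_between_large_sets m r {e \<in> cross_pairs m r. b e}}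
        \<le> real (r\<^sup>2) * (1/2) ^ m"
      using assms(1,2) unfolding C_def by (intro prob_not_dense_le) auto
    moreover have "measure_pmf.prob ?M {b. \<not> dense_between_large_sets m r {e \<in> cross_pairs m r. b e}}
        = 1 - measure_pmf.prob ?M {b. dense_between_large_sets m r {e \<in> cross_pairs m r. b e}}"
      using measure_pmf.prob_compl[of "{b. dense_between_large_sets m r {e \<in> cross_pairs m r. b e}}" ?M]
      by (simp add: Compl_eq_Diff_UNIV[symmetric] Collect_neg_eq[symmetric])
    moreover have "measure_pmf.prob ?M {b. dense_between_large_sets m r {e \<in> cross_pairs m r. b e}} \<le> ?P m"
      unfolding random_partite_graph_def measure_map_pmf
      using chromatic_numbers_of_dense_partite_graph[OF _ _ elim(2)]
      by (intro measure_pmf.finite_measure_mono) auto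
    ultimately show ?case by simp
  qed
  show ?thesis
  proof (rule tendsto_sandwich[OF lower])
    have "(\<lambda>m. 1 - real (r\<^sup>2) * (1/2) ^ m) \<longlonglongrightarrow> 1 - real (r\<^sup>2) * 0"
      by (intro tendsto_intros LIMSEQ_power_zero) auto
    then show "(\<lambda>m. 1 - real (r\<^sup>2) * (1/2) ^ m) \<longlonglongrightarrow> 1" by simp
  qed auto
qed

end
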